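(* Let $(X,\cdot,\ast)$ be a P{\l}onka bi-magma and let $R=R_{(\cdot,\ast)}:X\times X\to X\times X$, $R(x,y)=(x\cdot y,\ x\ast y)$, be the associated canonical YB-solution. Then: (1) $R$ is bi-connected if and only if there exists a connected pair $(f,g)$ of commuting maps $f,g:X\to X$ such that $R=R_{(f,g)}$, i.e. $R(x,y)=(f(x),g(y))$ for all $x,y\in X$. (2) In particular, if $\ast=\cdot_{\rm op}$ (i.e. $x\ast y=y\cdot x$ for all $x,y$), then $R=R_{(\cdot,\cdot_{\rm op})}$ is bi-connected if and only if there exists a connected map $f:X\to X$ such that $R(x,y)=(f(x),f(y))$ for all $x,y\in X$. Moreover, for every positive integer $n$, the number of isomorphism classes of bi-connected solutions of the form $R_{(\cdot,\cdot_{\rm op})}$ associated to right P{\l}onka magmas $(X,\cdot)$ of order $n$ is the Harary number $\mathfrak{c}(n)$.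
   Context: A bi-magma $(X,\cdot,\ast)$ is a set with two binary operations. A right P{\l}onka magma is a set $X$ with a binary operation satisfying $(x\cdot y)\cdot z=(x\cdot z)\cdot y$ and $x\cdot(y\cdot z)=x\cdot y$ for all $x,y,z$. A P{\l}onka bi-magma is a bi-magma such that $(X,\cdot)$ is a right P{\l}onka magma and for all $x,y,z\in X$: - $x\ast(y\ast z)=y\ast(x\ast z)$ and $(x\ast y)\ast z=y\ast z$; - $x\ast(y\cdot z)=(x\ast y)\cdot z$, $\ (x\cdot z)\ast y=x\ast y$, $\ x\cdot(y\ast z)=x\cdot z$. If $(X,\cdot)$ is a right P{\l}onka magma then $(X,\cdot,\cdot_{\rm op})$ is a P{\l}onka bi-magma. For every P{\l}onka bi-magma, $R_{(\cdot,\ast)}$ is a solution of the set-theoretic Yang--Baxter equation $R^{12}R^{13}R^{23}=R^{23}R^{13}R^{12}$ on $X^3$ (a "YB-solution"). Two solutions $(X,R)$, $(X',R')$ are isomorphic if there is a bijection $\sigma:X\to X'$ with $(\sigma\times\sigma)\circ R=R'\circ(\sigma\times\sigma)$. A non-trivial partition $X=\coprod_{i\in I}X_i$ is one into at least two non-empty parts. A map $R:X\times X\to X\times X$ is bi-connected if there is no non-trivial partition $X=\coprod_{i\in I}X_i$ with $R(X_i\times X_i)\subseteq X_i\times X_i$ for all $i\in I$. A family $\mathcal{F}$ of maps $X\to X$ is connected if there is no non-trivial partition $X=\coprod_{i\in I}X_i$ with $f(X_i)\subseteq X_i$ for all $f\in\mathcal{F}$ and $i\in I$; a map $f$ is connected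 if $\{f\}$ is, and a pair $(f,g)$ is connected if $\{f,g\}$ is. The Harary number $\mathfrak{c}(n)$ is the number of conjugacy classes (under the symmetric group) of connected maps $\{1,\dots,n\}\to\{1,\dots,n\}$. *)

theory Defs
  imports
    "HOL-Library.FuncSet"
    "HOL-Library.Disjoint_Sets"
    "HOL-Library.Infinite_Typeclass"
    "HOL-Combinatorics.Permutations"
begin

(* Structures live on an explicit carrier X; values of operations and maps outside X
   are irrelevant. X may be empty. *)

locale right_plonka_magma =
  fixes X :: "'a set" and dot :: "'a \<Rightarrow> 'a \<Rightarrow> 'a" (infixl "\<cdot>" 70)
  assumes dot_closed: "\<lbrakk>x \<in> X; y \<in> X\<rbrakk> \<Longrightarrow> x \<cdot> y \<in> X"
    and dot_right_commute:
      "\<lbrakk>x \<in> X; y \<in> X; z \<in> X\<rbrakk> \<Longrightarrow> (x \<cdot> y) \<cdot> z = (x \<cdot> z) \<cdot> y"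
    and dot_right_absorb:
      "\<lbrakk>x \<in> X; y \<in> X; z \<in> X\<rbrakk> \<Longrightarrow> x \<cdot> (y \<cdot> z) = x \<cdot> y"

locale plonka_bimagma = right_plonka_magma X dot
  for X :: "'a set" and dot :: "'a \<Rightarrow> 'a \<Rightarrow> 'a" (infixl "\<cdot>" 70) +
  fixes ast :: "'a \<Rightarrow> 'a \<Rightarrow> 'a" (infixl "\<star>" 70)
  assumes ast_closed: "\<lbrakk>x \<in> X; y \<in> X\<rbrakk> \<Longrightarrow> x \<star> y \<in> X"
    and ast_left_commute:
      "\<lbrakk>x \<in> X; y \<in> X; z \<in> X\<rbrakk> \<Longrightarrow> x \<star> (y \<star> z) = y \<star> (x \<star> z)"
    and ast_left_absorb:
      "\<lbrakk>x \<in> X; y \<in> X; z \<in> X\<rbrakk> \<Longrightarrow> (x \<star> y) \<star> z = y \<star> z"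
    and ast_dot_assoc:
      "\<lbrakk>x \<in> X; y \<in> X; z \<in> X\<rbrakk> \<Longrightarrow> x \<star> (y \<cdot> z) = (x \<star> y) \<cdot> z"
    and dot_ast_absorb:
      "\<lbrakk>x \<in> X; y \<in> X; z \<in> X\<rbrakk> \<Longrightarrow> (x \<cdot> z) \<star> y = x \<star> y"
    and ast_dot_absorb:
      "\<lbrakk>x \<in> X; y \<in> X; z \<in> X\<rbrakk> \<Longrightarrow> x \<cdot> (y \<star> z) = x \<cdot> z"

definition op_dot :: "('a \<Rightarrow> 'a \<Rightarrow> 'a) \<Rightarrow> 'a \<Rightarrow> 'a \<Rightarrow> 'a" where
  "op_dot dot x y = dot y x"

definition bimagma_map ::
  "('a \<Rightarrow> 'a \<Rightarrow> 'a) \<Rightarrow> ('a \<Rightarrow> 'a \<Rightarrow> 'a) \<Rightarrow> 'a \<times> 'a \<Rightarrow> 'a \<times> 'a" where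
  "bimagma_map dot ast = (\<lambda>(x, y). (dot x y, ast x y))"

definition map12 :: "('a \<times> 'a \<Rightarrow> 'a \<times> 'a) \<Rightarrow> 'a \<times> 'a \<times> 'a \<Rightarrow> 'a \<times> 'a \<times> 'a" where
  "map12 R = (\<lambda>(x, y, z). case R (x, y) of (u, v) \<Rightarrow> (u, v, z))"

definition map13 :: "('a \<times> 'a \<Rightarrow> 'a \<times> 'a) \<Rightarrow> 'a \<times> 'a \<times> 'a \<Rightarrow> 'a \<times> 'a \<times> 'a" where
  "map13 R = (\<lambda>(x, y, z). case R (x, z) of (u, w) \<Rightarrow> (u, y, w))"

definition map23 :: "('a \<times> 'a \<Rightarrow> 'a \<times> 'a) \<Rightarrow> 'a \<times> 'a \<times> 'a \<Rightarrow> 'a \<times> 'a \<times> 'a" where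
  "map23 R = (\<lambda>(x, y, z). case R (y, z) of (v, w) \<Rightarrow> (x, v, w))"

definition yb_solution :: "'a set \<Rightarrow> ('a \<times> 'a \<Rightarrow> 'a \<times> 'a) \<Rightarrow> bool" where
  "yb_solution X R \<longleftrightarrow> R \<in> X \<times> X \<rightarrow> X \<times> X \<and>
     (\<forall>t \<in> X \<times> X \<times> X.
        (map12 R \<circ> map13 R \<circ> map23 R) t = (map23 R \<circ> map13 R \<circ> map12 R) t)"

definition isomorphic_solutions ::
  "'a set \<times> ('a \<times> 'a \<Rightarrow> 'a \<times> 'a) \<Rightarrow> 'b set \<times> ('b \<times> 'b \<Rightarrow> 'b \<times> 'b) \<Rightarrow> bool" where
  "isomorphic_solutions = (\<lambda>(X, R) (X', R').
     \<exists>\<sigma>. bij_betw \<sigma> X X' \<and>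
         (\<forall>p \<in> X \<times> X. (map_prod \<sigma> \<sigma> \<circ> R) p = (R' \<circ> map_prod \<sigma> \<sigma>) p))"

(* Not "2 \<le> card P", since P may be infinite. *)
definition nontrivial_partition :: "'a set \<Rightarrow> 'a set set \<Rightarrow> bool" where
  "nontrivial_partition X P \<longleftrightarrow> partition_on X P \<and> (\<exists>A \<in> P. \<exists>B \<in> P. A \<noteq> B)"

definition bi_connected :: "'a set \<Rightarrow> ('a \<times> 'a \<Rightarrow> 'a \<times> 'a) \<Rightarrow> bool" where
  "bi_connected X R \<longleftrightarrow>
     \<not> (\<exists>P. nontrivial_partition X P \<and> (\<forall>A \<in> P. R ` (A \<times> A) \<subseteq> A \<times> A))"

definition connected_family :: "'a set \<Rightarrow> ('a \<Rightarrow> 'a) set \<Rightarrow> bool" where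
  "connected_family X F \<longleftrightarrow>
     \<not> (\<exists>P. nontrivial_partition X P \<and> (\<forall>f \<in> F. \<forall>A \<in> P. f ` A \<subseteq> A))"

definition connected_map :: "'a set \<Rightarrow> ('a \<Rightarrow> 'a) \<Rightarrow> bool" where
  "connected_map X f \<longleftrightarrow> connected_family X {f}"

definition connected_pair :: "'a set \<Rightarrow> ('a \<Rightarrow> 'a) \<Rightarrow> ('a \<Rightarrow> 'a) \<Rightarrow> bool" where
  "connected_pair X f g \<longleftrightarrow> connected_family X {f, g}"

definition connected_self_maps :: "nat \<Rightarrow> (nat \<Rightarrow> nat) set" where
  "connected_self_maps n = {f \<in> {1..n} \<rightarrow>\<^sub>E {1..n}. connected_map {1..n} f}"

definition conjugacy :: "nat \<Rightarrow> ((nat \<Rightarrow> nat) \<times> (nat \<Rightarrow> nat)) set" where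
  "conjugacy n = {(f, g). f \<in> connected_self_maps n \<and> g \<in> connected_self_maps n \<and>
     (\<exists>\<sigma>. \<sigma> permutes {1..n} \<and> g = restrict (\<sigma> \<circ> f \<circ> inv \<sigma>) {1..n})}"

definition harary :: "nat \<Rightarrow> nat" where
  "harary n = card (connected_self_maps n // conjugacy n)"

(* Solutions of order n with carrier drawn from the type 'a; for infinite 'a every
   solution of order n is isomorphic to one of these. R is not required to be
   extensional: maps agreeing on X \<times> X give isomorphic solutions. *)
definition bi_connected_op_solutions ::
  "nat \<Rightarrow> ('a set \<times> ('a \<times> 'a \<Rightarrow> 'a \<times> 'a)) set" where
  "bi_connected_op_solutions n = {(X, R). finite X \<and> card X = n \<and>
     yb_solution X R \<and> bi_connected X R \<and>
     (\<exists>dot. right_plonka_magma X dot \<and>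
             (\<forall>p \<in> X \<times> X. R p = bimagma_map dot (op_dot dot) p))}"

definition bi_connected_op_solution_classes ::
  "nat \<Rightarrow> ('a set \<times> ('a \<times> 'a \<Rightarrow> 'a \<times> 'a)) set set" where
  "bi_connected_op_solution_classes n = bi_connected_op_solutions n //
     {(s, t). s \<in> bi_connected_op_solutions n \<and> t \<in> bi_connected_op_solutions n \<and>
              isomorphic_solutions s t}"

end

theory Submission
  imports Defs
begin

text \<open>
  Call two elements equivalent if they have the same right translation for the first operation and
  the same left translation for the second one. The absorption laws say that \<open>x \<cdot> y\<close> is equivalent to
  \<open>x\<close> and \<open>x \<star> y\<close> to \<open>y\<close>, so that \<open>R\<close> preserves the square of every equivalence class. If \<open>R\<close> is
  bi-connected there is thus only one class, which means that \<open>R (x, y) = (f x, g y)\<close>. For such a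
  product map the squares \<open>A \<times> A\<close> preserved by \<open>R\<close> are exactly those with \<open>A\<close> preserved by \<open>f\<close> and
  \<open>g\<close>. For \<open>\<star> = \<cdot>\<^sub>o\<^sub>p\<close> one gets \<open>f = g\<close>, and isomorphism of solutions amounts to conjugacy of the maps.
\<close>

section \<open>Connectedness tested on single subsets\<close>

lemma connected_familyI:
  assumes "\<And>S. \<lbrakk>S \<subseteq> X; \<And>f. f \<in> F \<Longrightarrow> f ` S \<subseteq> S; \<And>f. f \<in> F \<Longrightarrow> f ` (X - S) \<subseteq> X - S\<rbrakk>
    \<Longrightarrow> S = {} \<or> S = X"
  shows "connected_family X F"
  unfolding connected_family_def
proof
  assume "\<exists>P. nontrivial_partition X P \<and> (\<forall>f\<in>F. \<forall>A\<in>P. f ` A \<subseteq> A)"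
  then obtain P A B where P: "partition_on X P" "\<forall>f\<in>F. \<forall>A\<in>P. f ` A \<subseteq> A"
    and AB: "A \<in> P" "B \<in> P" "A \<noteq> B"
    unfolding nontrivial_partition_def by blast
  have disj: "C = D \<or> C \<inter> D = {}" if "C \<in> P" "D \<in> P" for C D
    using P(1) that unfolding partition_on_def disjoint_def by auto
  have ne: "C \<noteq> {}" if "C \<in> P" for C
    using P(1) that unfolding partition_on_def by auto
  have union: "X = \<Union>P" using P(1) unfolding partition_on_def by auto
  \<comment> \<open>The complement of \<open>A\<close> is the union of the other blocks, each of
    which \<open>f\<close> preserves.\<close>
  have compl: "f ` (X - A) \<subseteq> X - A" if "f \<in> F" for f
  proof (rule image_subsetI)
    fix x assume x: "x \<in> X - A"
    then obtain C where C: "C \<in> P" "x \<in> C" using union by blast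
    then have "f x \<in> C" using P(2) that by blast
    moreover have "C \<inter> A = {}" using disj[OF C(1) AB(1)] C x by blast
    ultimately show "f x \<in> X - A" using C union by blast
  qed
  have "A \<subseteq> X" using AB(1) union by auto
  moreover have "f ` A \<subseteq> A" if "f \<in> F" for f using P(2) AB(1) that by simp
  ultimately have "A = {} \<or> A = X"
    using compl by (rule assms)
  moreover have "B \<subseteq> X" using AB(2) union by auto
  ultimately show False
    using ne[OF AB(1)] ne[OF AB(2)] disj[OF AB(1,2)] AB(3) by auto
qed

text \<open>A nonempty proper subset and its complement form a nontrivial partition. Together with
  \<open>connected_familyI\<close> this replaces partitions by single subsets, which are easily
  pulled back along a bijection.\<close>

lemma connected_familyD:
  assumes "connected_family X F" "S \<subseteq> X" "\<And>f. f \<in> F \<Longrightarrow> f ` S \<subseteq> S"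
    "\<And>f. f \<in> F \<Longrightarrow> f ` (X - S) \<subseteq> X - S"
  shows "S = {} \<or> S = X"
proof (rule ccontr)
  assume neg: "\<not> ?thesis"
  have "nontrivial_partition X {S, X - S}"
    using neg assms(2) unfolding nontrivial_partition_def partition_on_def disjoint_def by auto
  moreover have "\<forall>f\<in>F. \<forall>A\<in>{S, X - S}. f ` A \<subseteq> A"
    using assms(3,4) by simp
  ultimately show False
    using assms(1) unfolding connected_family_def by blast
qed

text \<open>On a block the image of the square is the product of the images under \<open>f\<close>
  and \<open>g\<close>, so the square is preserved exactly when both factors stay in the
  block.\<close>

lemma bi_connected_product_iff:
  assumes "\<And>x y. \<lbrakk>x \<in> X; y \<in> X\<rbrakk> \<Longrightarrow> R (x, y) = (f x, g y)"
  shows "bi_connected X R \<longleftrightarrow> connected_pair X f g"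
proof -
  have inv: "R ` (A \<times> A) \<subseteq> A \<times> A \<longleftrightarrow> (\<forall>h\<in>{f, g}. h ` A \<subseteq> A)"
    if "nontrivial_partition X P" "A \<in> P" for A P
  proof -
    have "A \<subseteq> X"
      using that unfolding nontrivial_partition_def partition_on_def by auto
    then have "R ` (A \<times> A) = f ` A \<times> g ` A"
      using assms by (force simp: subset_iff image_iff)
    then show ?thesis by auto
  qed
  have "nontrivial_partition X P \<and> (\<forall>A\<in>P. R ` (A \<times> A) \<subseteq> A \<times> A) \<longleftrightarrow>
      nontrivial_partition X P \<and> (\<forall>h\<in>{f, g}. \<forall>A\<in>P. h ` A \<subseteq> A)" for P
    using inv[of P] by (metis (no_types, lifting))
  then show ?thesis
    unfolding bi_connected_def connected_pair_def connected_family_def by simp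
qed

section \<open>Bi-connected Plonka bi-magmas\<close>

context plonka_bimagma
begin

lemma bi_connected_imp_translations_eq:
  assumes "bi_connected X (bimagma_map dot ast)" "x \<in> X" "y \<in> X" "z \<in> X"
  shows "z \<cdot> x = z \<cdot> y" and "x \<star> z = y \<star> z"
proof -
  define E where "E = {(x, y). x \<in> X \<and> y \<in> X \<and> (\<forall>z\<in>X. z \<cdot> x = z \<cdot> y \<and> x \<star> z = y \<star> z)}"
  have E: "equiv X E"
    unfolding E_def by (intro equivI refl_onI symI transI) auto
  have part: "partition_on X (X // E)"
    using E by (rule partition_on_quotient)
  have inv: "bimagma_map dot ast ` (A \<times> A) \<subseteq> A \<times> A" if A: "A \<in> X // E" for A
  proof -
    have "u \<cdot> v \<in> A \<and> u \<star> v \<in> A" if uv: "u \<in> A" "v \<in> A" for u v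
    proof -
      have X: "u \<in> X" "v \<in> X"
        using in_quotient_imp_subset[OF E A] uv by auto
      \<comment> \<open>Each of the four equations is one absorption law:
        \<open>dot_right_absorb\<close> and \<open>dot_ast_absorb\<close> for the pair
        \<open>(u, u \<cdot> v)\<close>, \<open>ast_dot_absorb\<close> and
        \<open>ast_left_absorb\<close> for \<open>(v, u \<star> v)\<close>.\<close>
      have "(u, u \<cdot> v) \<in> E" "(v, u \<star> v) \<in> E"
        unfolding E_def using X
        by (auto simp: dot_closed ast_closed dot_right_absorb ast_left_absorb
            dot_ast_absorb ast_dot_absorb)
      then show ?thesis
        using in_quotient_imp_closed[OF E A] uv by blast
    qed
    then show ?thesis by (auto simp: bimagma_map_def)
  qed
  have "E `` {x} = E `` {y}"
  proof (rule ccontr)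
    assume "E `` {x} \<noteq> E `` {y}"
    then have "nontrivial_partition X (X // E)"
      unfolding nontrivial_partition_def using part assms(2,3) by (blast intro: quotientI)
    then show False
      using assms(1) inv unfolding bi_connected_def by blast
  qed
  then have "(x, y) \<in> E"
    using E assms(2,3) by (simp add: eq_equiv_class)
  then show "z \<cdot> x = z \<cdot> y" and "x \<star> z = y \<star> z"
    using assms(4) by (auto simp: E_def)
qed

lemma bi_connected_iff:
  "bi_connected X (bimagma_map dot ast) \<longleftrightarrow>
    (\<exists>f g. f \<in> X \<rightarrow> X \<and> g \<in> X \<rightarrow> X \<and> (\<forall>x\<in>X. f (g x) = g (f x)) \<and> connected_pair X f g \<and>
       (\<forall>x\<in>X. \<forall>y\<in>X. bimagma_map dot ast (x, y) = (f x, g y)))"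
    (is "?L \<longleftrightarrow> ?R")
proof
  assume L: ?L
  \<comment> \<open>By the previous lemma \<open>x \<cdot> y\<close> is independent of
    \<open>y\<close> and \<open>x \<star> y\<close> of \<open>x\<close>. Evaluating on the diagonal
    avoids a base point, so an empty \<open>X\<close> is covered as well.\<close>
  define f where "f x = x \<cdot> x" for x
  define g where "g x = x \<star> x" for x
  have f: "x \<cdot> y = f x" and g: "x \<star> y = g y" if "x \<in> X" "y \<in> X" for x y
    using bi_connected_imp_translations_eq[OF L] that unfolding f_def g_def by blast+
  have fX: "f \<in> X \<rightarrow> X" and gX: "g \<in> X \<rightarrow> X"
    by (auto simp: f_def g_def dot_closed ast_closed)
  \<comment> \<open>With all three arguments equal to \<open>x\<close>, the law
    \<open>ast_dot_assoc\<close> reads \<open>g (f x) = f (g x)\<close>.\<close>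
  have "f (g x) = g (f x)" if "x \<in> X" for x
    using ast_dot_assoc[OF that that that] f g fX gX that by (metis PiE)
  moreover have R: "bimagma_map dot ast (x, y) = (f x, g y)" if "x \<in> X" "y \<in> X" for x y
    using f g that by (simp add: bimagma_map_def)
  moreover have "connected_pair X f g"
    using bi_connected_product_iff[of X "bimagma_map dot ast" f g] R L by blast
  ultimately show ?R using fX gX by blast
next
  assume ?R
  then obtain f g where "connected_pair X f g"
    and "\<And>x y. \<lbrakk>x \<in> X; y \<in> X\<rbrakk> \<Longrightarrow> bimagma_map dot ast (x, y) = (f x, g y)"
    by blast
  then show ?L
    using bi_connected_product_iff[of X "bimagma_map dot ast" f g] by simp
qed

lemma bi_connected_op_iff:
  assumes "\<And>x y. \<lbrakk>x \<in> X; y \<in> X\<rbrakk> \<Longrightarrow> x \<star> y = y \<cdot> x"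
  shows "bi_connected X (bimagma_map dot ast) \<longleftrightarrow>
    (\<exists>f. f \<in> X \<rightarrow> X \<and> connected_map X f \<and>
       (\<forall>x\<in>X. \<forall>y\<in>X. bimagma_map dot ast (x, y) = (f x, f y)))"
    (is "?L \<longleftrightarrow> ?R")
proof
  assume L: ?L
  then obtain f g where f: "f \<in> X \<rightarrow> X"
    and R: "\<forall>x\<in>X. \<forall>y\<in>X. bimagma_map dot ast (x, y) = (f x, g y)"
    using bi_connected_iff by blast
  \<comment> \<open>The second component \<open>x \<star> y = y \<cdot> x\<close> is the first
    component at the swapped pair \<open>(y, x)\<close>, hence \<open>f y\<close>; so
    \<open>f\<close> can take the place of \<open>g\<close>.\<close>
  have R': "bimagma_map dot ast (x, y) = (f x, f y)" if "x \<in> X" "y \<in> X" for x y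
    using R assms that by (simp add: bimagma_map_def)
  have "connected_pair X f f"
    using bi_connected_product_iff[of X "bimagma_map dot ast" f f] R' L by blast
  then show ?R
    using f R' by (auto simp: connected_pair_def connected_map_def)
next
  assume ?R
  then obtain f where "connected_map X f"
    and R: "\<And>x y. \<lbrakk>x \<in> X; y \<in> X\<rbrakk> \<Longrightarrow> bimagma_map dot ast (x, y) = (f x, f y)"
    by blast
  then show ?L
    using bi_connected_product_iff[of X "bimagma_map dot ast" f f, OF R] by (simp add: connected_pair_def connected_map_def)
qed

end

text \<open>Written out for the opposite operation, left commutation and mixed associativity both
  become right commutation, and the three absorption laws for the second operation become right
  absorption.\<close>

lemma (in right_plonka_magma) plonka_bimagma_op: "plonka_bimagma X dot (op_dot dot)"
  by unfold_locales
    (auto simp: op_dot_def dot_closed dot_right_absorb intro: dot_right_commute)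

section \<open>Isomorphism and conjugacy of self-maps\<close>

definition map_iso :: "'a set \<Rightarrow> ('a \<Rightarrow> 'a) \<Rightarrow> 'b set \<Rightarrow> ('b \<Rightarrow> 'b) \<Rightarrow> bool" where
  "map_iso X f Y g \<longleftrightarrow> (\<exists>\<sigma>. bij_betw \<sigma> X Y \<and> (\<forall>x\<in>X. \<sigma> (f x) = g (\<sigma> x)))"

lemma map_iso_refl: "map_iso X f X f"
  unfolding map_iso_def by (rule exI[of _ id]) auto

lemma map_iso_sym:
  assumes "map_iso X f Y g" "f \<in> X \<rightarrow> X"
  shows "map_iso Y g X f"
proof -
  obtain \<sigma> where \<sigma>: "bij_betw \<sigma> X Y" "\<forall>x\<in>X. \<sigma> (f x) = g (\<sigma> x)"
    using assms(1) unfolding map_iso_def by blast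
  have "inv_into X \<sigma> (g y) = f (inv_into X \<sigma> y)" if "y \<in> Y" for y
  proof -
    obtain x where x: "x \<in> X" "y = \<sigma> x"
      using bij_betw_imp_surj_on[OF \<sigma>(1)] \<open>y \<in> Y\<close> by (metis imageE)
    then have "inv_into X \<sigma> (g y) = inv_into X \<sigma> (\<sigma> (f x))"
      using \<sigma>(2) by simp
    \<comment> \<open>Cancelling \<open>inv_into X \<sigma>\<close> against \<open>\<sigma>\<close>
      at \<open>f x\<close> requires \<open>f x \<in> X\<close>; this is where closure of
      \<open>f\<close> enters.\<close>
    then show ?thesis
      using x \<sigma>(1) assms(2) by (auto simp: bij_betw_def inv_into_f_f Pi_iff)
  qed
  then show ?thesis
    unfolding map_iso_def using bij_betw_inv_into[OF \<sigma>(1)] by blast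
qed

lemma map_iso_trans:
  assumes "map_iso X f Y g" "map_iso Y g Z h"
  shows "map_iso X f Z h"
proof -
  obtain \<sigma> \<tau> where \<sigma>: "bij_betw \<sigma> X Y" "\<forall>x\<in>X. \<sigma> (f x) = g (\<sigma> x)"
    and \<tau>: "bij_betw \<tau> Y Z" "\<forall>y\<in>Y. \<tau> (g y) = h (\<tau> y)"
    using assms unfolding map_iso_def by blast
  have "\<forall>x\<in>X. (\<tau> \<circ> \<sigma>) (f x) = h ((\<tau> \<circ> \<sigma>) x)"
    using \<sigma> \<tau> bij_betwE[OF \<sigma>(1)] by simp
  then show ?thesis
    unfolding map_iso_def using bij_betw_trans[OF \<sigma>(1) \<tau>(1)] by blast
qed

text \<open>If \<open>S\<close> and its complement are stable under \<open>g\<close>, then the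
  preimage of \<open>S\<close> and its complement are stable under \<open>f\<close>. The preimage is
  therefore empty or all of \<open>X\<close>, and surjectivity of the bijection carries this back to
  \<open>S\<close>.\<close>

lemma map_iso_connected:
  assumes "map_iso X f Y g" "connected_map X f" "f \<in> X \<rightarrow> X"
  shows "connected_map Y g"
  unfolding connected_map_def
proof (rule connected_familyI)
  fix S assume S: "S \<subseteq> Y" "\<And>h. h \<in> {g} \<Longrightarrow> h ` S \<subseteq> S" "\<And>h. h \<in> {g} \<Longrightarrow> h ` (Y - S) \<subseteq> Y - S"
  obtain \<sigma> where \<sigma>: "bij_betw \<sigma> X Y" "\<forall>x\<in>X. \<sigma> (f x) = g (\<sigma> x)"
    using assms(1) unfolding map_iso_def by blast
  let ?T = "{x \<in> X. \<sigma> x \<in> S}"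
  have Y: "\<sigma> ` X = Y" using \<sigma>(1) by (auto simp: bij_betw_def)
  have fX: "f x \<in> X" if "x \<in> X" for x using assms(3) that by auto
  have "f ` ?T \<subseteq> ?T" using S(2)[of g] \<sigma>(2) fX by auto
  moreover have "f ` (X - ?T) \<subseteq> X - ?T" using S(3)[of g] \<sigma>(2) fX Y by fastforce
  ultimately have "?T = {} \<or> ?T = X"
    using assms(2) connected_familyD[of X "{f}" ?T] unfolding connected_map_def by auto
  then show "S = {} \<or> S = Y" using S(1) Y by blast
qed

text \<open>The witness is the conjugate of \<open>f\<close> by \<open>\<sigma>\<close>, made
  extensional so that for \<open>Y = {1..n}\<close> it can be a member of
  \<open>connected_self_maps n\<close>.\<close>

lemma map_iso_transport:
  assumes "bij_betw \<sigma> X Y" "f \<in> X \<rightarrow> X"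
  obtains g where "g \<in> Y \<rightarrow>\<^sub>E Y" "map_iso X f Y g"
proof
  let ?g = "restrict (\<sigma> \<circ> f \<circ> inv_into X \<sigma>) Y"
  show "?g \<in> Y \<rightarrow>\<^sub>E Y"
    using bij_betwE[OF assms(1)] bij_betwE[OF bij_betw_inv_into[OF assms(1)]] assms(2)
    by (simp add: Pi_iff)
  have "\<forall>x\<in>X. \<sigma> (f x) = ?g (\<sigma> x)"
    using assms(1) by (auto simp: bij_betw_def inv_into_f_f)
  then show "map_iso X f Y ?g"
    unfolding map_iso_def using assms(1) by blast
qed

text \<open>Restates conjugacy through \<open>map_iso\<close>, which also compares maps on carriers
  of different types and thus serves both sides of the count.\<close>

lemma conjugacy_iff:
  "(f, g) \<in> conjugacy n \<longleftrightarrow>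
    f \<in> connected_self_maps n \<and> g \<in> connected_self_maps n \<and> map_iso {1..n} f {1..n} g"
proof -
  have "(\<exists>\<sigma>. \<sigma> permutes {1..n} \<and> g = restrict (\<sigma> \<circ> f \<circ> inv \<sigma>) {1..n}) \<longleftrightarrow>
      map_iso {1..n} f {1..n} g" (is "?L \<longleftrightarrow> ?R")
    if fg: "f \<in> {1..n} \<rightarrow>\<^sub>E {1..n}" "g \<in> {1..n} \<rightarrow>\<^sub>E {1..n}"
  proof
    assume ?L
    then obtain \<sigma> where \<sigma>: "\<sigma> permutes {1..n}" "g = restrict (\<sigma> \<circ> f \<circ> inv \<sigma>) {1..n}" by blast
    have "\<forall>x\<in>{1..n}. \<sigma> (f x) = g (\<sigma> x)"
      unfolding \<sigma>(2) using permutes_in_image[OF \<sigma>(1)] permutes_inverses(2)[OF \<sigma>(1)] by simp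
    then show ?R
      unfolding map_iso_def using permutes_imp_bij[OF \<sigma>(1)] by blast
  next
    assume ?R
    then obtain \<tau> where \<tau>: "bij_betw \<tau> {1..n} {1..n}" "\<forall>x\<in>{1..n}. \<tau> (f x) = g (\<tau> x)"
      unfolding map_iso_def by blast
    \<comment> \<open>A permutation of \<open>{1..n}\<close> in the sense of \<open>permutes\<close>
      must fix every other number, so the bijection is extended by the identity.\<close>
    define \<sigma> where "\<sigma> x = (if x \<in> {1..n} then \<tau> x else x)" for x
    have "bij_betw \<sigma> {1..n} {1..n}"
      using \<tau>(1) by (rule bij_betw_cong[THEN iffD1, rotated]) (simp add: \<sigma>_def)
    then have perm: "\<sigma> permutes {1..n}"
      by (rule bij_imp_permutes) (simp only: \<sigma>_def if_False)
    have "g x = restrict (\<sigma> \<circ> f \<circ> inv \<sigma>) {1..n} x" for x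
    proof (cases "x \<in> {1..n}")
      case True
      define y where "y = inv \<sigma> x"
      have y: "y \<in> {1..n}" "\<sigma> y = x"
        using permutes_in_image[OF permutes_inv[OF perm]] True permutes_inverses(1)[OF perm]
        by (simp_all add: y_def)
      moreover have "f y \<in> {1..n}" using fg(1) y(1) by blast
      ultimately have "\<sigma> (f y) = g x" using \<tau>(2) unfolding \<sigma>_def by auto
      then show ?thesis using True by (simp add: y_def)
    next
      case False
      \<comment> \<open>Outside \<open>{1..n}\<close> both sides are \<open>undefined\<close>:
        \<open>g\<close> is extensional and the conjugate is restricted.\<close>
      then show ?thesis using PiE_arb[OF fg(2) False] by (simp only: restrict_apply if_False)
    qed
    then have "g = restrict (\<sigma> \<circ> f \<circ> inv \<sigma>) {1..n}" by (rule ext)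
    then show ?L using perm by blast
  qed
  then show ?thesis
    unfolding conjugacy_def connected_self_maps_def by blast
qed

section \<open>Solutions given by a single self-map\<close>

lemma isomorphic_solutions_iff_map_iso:
  assumes "\<And>x y. \<lbrakk>x \<in> X; y \<in> X\<rbrakk> \<Longrightarrow> R (x, y) = (f x, f y)"
    and "\<And>x y. \<lbrakk>x \<in> Y; y \<in> Y\<rbrakk> \<Longrightarrow> S (x, y) = (g x, g y)"
  shows "isomorphic_solutions (X, R) (Y, S) \<longleftrightarrow> map_iso X f Y g"
proof -
  \<comment> \<open>The condition at \<open>(x, y)\<close> consists of the intertwining equations at
    \<open>x\<close> and at \<open>y\<close>; the diagonal pairs already yield every
    \<open>x\<close>.\<close>
  have "(\<forall>p\<in>X \<times> X. (map_prod \<sigma> \<sigma> \<circ> R) p = (S \<circ> map_prod \<sigma> \<sigma>) p) \<longleftrightarrow>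
      (\<forall>x\<in>X. \<sigma> (f x) = g (\<sigma> x))" if "bij_betw \<sigma> X Y" for \<sigma>
    using assms bij_betwE[OF that] by auto
  then show ?thesis
    unfolding isomorphic_solutions_def map_iso_def by auto
qed

text \<open>One direction is the bi-connectedness criterion for the opposite operation. Conversely,
  any connected \<open>f\<close> arises, from the magma whose product is \<open>f\<close> of the
  left factor.\<close>

lemma bi_connected_op_solutions_iff:
  "(X, R) \<in> bi_connected_op_solutions n \<longleftrightarrow>
    finite X \<and> card X = n \<and>
    (\<exists>f. f \<in> X \<rightarrow> X \<and> connected_map X f \<and> (\<forall>x\<in>X. \<forall>y\<in>X. R (x, y) = (f x, f y)))"
    (is "?L \<longleftrightarrow> ?R")
proof
  assume ?L
  then obtain dot where fin: "finite X" "card X = n" and con: "bi_connected X R"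
    and dot: "right_plonka_magma X dot"
    and R: "\<forall>p\<in>X \<times> X. R p = bimagma_map dot (op_dot dot) p"
    unfolding bi_connected_op_solutions_def by blast
  interpret right_plonka_magma X dot by (fact dot)
  interpret plonka_bimagma X dot "op_dot dot" by (rule plonka_bimagma_op)
  \<comment> \<open>\<open>R\<close> agrees with the canonical map only on
    \<open>X \<times> X\<close>, but bi-connectedness looks only at squares of blocks inside
    \<open>X\<close>.\<close>
  have "R ` (A \<times> A) = bimagma_map dot (op_dot dot) ` (A \<times> A)"
    if "nontrivial_partition X P" "A \<in> P" for A P
  proof (rule image_cong[OF refl])
    fix p assume "p \<in> A \<times> A"
    moreover have "A \<subseteq> X"
      using that unfolding nontrivial_partition_def partition_on_def by auto
    ultimately show "R p = bimagma_map dot (op_dot dot) p" using R by blast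
  qed
  then have "bi_connected X (bimagma_map dot (op_dot dot))"
    using con unfolding bi_connected_def by metis
  then show ?R
    using bi_connected_op_iff fin R by (simp add: op_dot_def)
next
  assume ?R
  then obtain f where fin: "finite X" "card X = n" and f: "f \<in> X \<rightarrow> X" "connected_map X f"
    and R: "\<And>x y. \<lbrakk>x \<in> X; y \<in> X\<rbrakk> \<Longrightarrow> R (x, y) = (f x, f y)"
    by blast
  have fX: "f x \<in> X" if "x \<in> X" for x using f(1) that by auto
  \<comment> \<open>Each coordinate is touched by exactly two of the three factors, so both
    composites apply \<open>f\<close> twice in every slot.\<close>
  have "yb_solution X R"
    unfolding yb_solution_def by (auto simp: R fX map12_def map13_def map23_def)
  moreover have "bi_connected X R"
    using bi_connected_product_iff[of X R f f, OF R] f(2) by (simp add: connected_pair_def connected_map_def)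
  moreover have "right_plonka_magma X (\<lambda>x y. f x)"
    by unfold_locales (auto simp: fX)
  moreover have "\<forall>p\<in>X \<times> X. R p = bimagma_map (\<lambda>x y. f x) (op_dot (\<lambda>x y. f x)) p"
    by (auto simp: R bimagma_map_def op_dot_def)
  ultimately show ?L
    unfolding bi_connected_op_solutions_def using fin by blast
qed

section \<open>Counting isomorphism classes\<close>

lemma bij_betw_quotient:
  assumes "equiv A r" "equiv B s" "\<Phi> \<in> A \<rightarrow> B"
    and iff: "\<And>a a'. \<lbrakk>a \<in> A; a' \<in> A\<rbrakk> \<Longrightarrow> (a, a') \<in> r \<longleftrightarrow> (\<Phi> a, \<Phi> a') \<in> s"
    and surj: "\<And>b. b \<in> B \<Longrightarrow> \<exists>a\<in>A. (\<Phi> a, b) \<in> s"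
  shows "bij_betw (\<lambda>C. s `` (\<Phi> ` C)) (A // r) (B // s)"
proof -
  \<comment> \<open>Saturating the image of a class under \<open>s\<close> gives the class of the
    image of any representative, so the induced map on quotients involves no choice.\<close>
  have cl: "s `` (\<Phi> ` (r `` {a})) = s `` {\<Phi> a}" if a: "a \<in> A" for a
  proof
    have sub: "r `` {a} \<subseteq> A" using equiv_type[OF assms(1)] by auto
    show "s `` (\<Phi> ` (r `` {a})) \<subseteq> s `` {\<Phi> a}"
    proof
      fix b assume "b \<in> s `` (\<Phi> ` (r `` {a}))"
      then obtain a' where a': "(a, a') \<in> r" "(\<Phi> a', b) \<in> s" by blast
      then have "(\<Phi> a, \<Phi> a') \<in> s" using iff a sub by blast
      then show "b \<in> s `` {\<Phi> a}"
        using a'(2) assms(2) by (meson Image_singleton_iff equivE transE)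
    qed
    show "s `` {\<Phi> a} \<subseteq> s `` (\<Phi> ` (r `` {a}))"
      using equiv_class_self[OF assms(1) a] by blast
  qed
  have mem: "\<Phi> a \<in> B" if "a \<in> A" for a using assms(3) that by auto
  show ?thesis
    unfolding bij_betw_def
  proof
    show "inj_on (\<lambda>C. s `` (\<Phi> ` C)) (A // r)"
    proof (rule inj_onI)
      fix C D assume "C \<in> A // r" "D \<in> A // r" and eq: "s `` (\<Phi> ` C) = s `` (\<Phi> ` D)"
      then obtain a a' where a: "a \<in> A" "a' \<in> A" "C = r `` {a}" "D = r `` {a'}"
        by (auto elim!: quotientE)
      then have "s `` {\<Phi> a} = s `` {\<Phi> a'}" using eq cl by simp
      then have "(a, a') \<in> r"
        using iff a(1,2) mem eq_equiv_class_iff[OF assms(2)] by blast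
      then show "C = D" using a equiv_class_eq[OF assms(1)] by blast
    qed
    show "(\<lambda>C. s `` (\<Phi> ` C)) ` (A // r) = B // s"
    proof
      show "(\<lambda>C. s `` (\<Phi> ` C)) ` (A // r) \<subseteq> B // s"
        using cl mem by (auto elim!: quotientE intro!: quotientI)
      show "B // s \<subseteq> (\<lambda>C. s `` (\<Phi> ` C)) ` (A // r)"
      proof
        fix D assume "D \<in> B // s"
        then obtain b where b: "b \<in> B" "D = s `` {b}" by (auto elim!: quotientE)
        then obtain a where a: "a \<in> A" "(\<Phi> a, b) \<in> s" using surj by blast
        have "D = s `` (\<Phi> ` (r `` {a}))"
          using b cl[OF a(1)] equiv_class_eq[OF assms(2) a(2)] by simp
        then show "D \<in> (\<lambda>C. s `` (\<Phi> ` C)) ` (A // r)"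
          using quotientI[OF a(1), of r] by blast
      qed
    qed
  qed
qed

lemma equiv_conjugacy: "equiv (connected_self_maps n) (conjugacy n)"
proof (intro equivI refl_onI symI transI)
  show "conjugacy n \<subseteq> connected_self_maps n \<times> connected_self_maps n"
    by (auto simp: conjugacy_iff)
  show "(f, f) \<in> conjugacy n" if "f \<in> connected_self_maps n" for f
    using that by (simp add: conjugacy_iff map_iso_refl)
  show "(g, f) \<in> conjugacy n" if "(f, g) \<in> conjugacy n" for f g
    using that map_iso_sym[of "{1..n}" f "{1..n}" g]
    by (auto simp: conjugacy_iff connected_self_maps_def)
  show "(f, h) \<in> conjugacy n" if "(f, g) \<in> conjugacy n" "(g, h) \<in> conjugacy n" for f g h
    using that map_iso_trans by (auto simp: conjugacy_iff)
qed

text \<open>Choosing one self-map \<open>F s\<close> for each solution \<open>s\<close> turns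
  isomorphism into \<open>map_iso\<close>, whose reflexivity, symmetry and transitivity are known.
  Symmetry uses that \<open>F s\<close> maps the carrier into itself.\<close>

lemma equiv_isomorphic_solutions:
  "equiv (bi_connected_op_solutions n :: ('a set \<times> ('a \<times> 'a \<Rightarrow> 'a \<times> 'a)) set)
    {(s, t). s \<in> bi_connected_op_solutions n \<and>
     t \<in> bi_connected_op_solutions n \<and> isomorphic_solutions s t}"
proof -
  let ?B = "bi_connected_op_solutions n :: ('a set \<times> ('a \<times> 'a \<Rightarrow> 'a \<times> 'a)) set"
  have rep: "\<exists>f. f \<in> fst s \<rightarrow> fst s \<and> (\<forall>x\<in>fst s. \<forall>y\<in>fst s. snd s (x, y) = (f x, f y))"
    if "s \<in> ?B" for s
    using that bi_connected_op_solutions_iff[of "fst s" "snd s" n] by auto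
  then obtain F :: "'a set \<times> ('a \<times> 'a \<Rightarrow> 'a \<times> 'a) \<Rightarrow> 'a \<Rightarrow> 'a"
    where F: "\<And>s. s \<in> ?B \<Longrightarrow> F s \<in> fst s \<rightarrow> fst s"
      "\<And>s x y. \<lbrakk>s \<in> ?B; x \<in> fst s; y \<in> fst s\<rbrakk> \<Longrightarrow> snd s (x, y) = (F s x, F s y)"
    by metis
  have iso: "isomorphic_solutions s t \<longleftrightarrow> map_iso (fst s) (F s) (fst t) (F t)"
    if "s \<in> ?B" "t \<in> ?B" for s t
    using isomorphic_solutions_iff_map_iso[of "fst s" "snd s" "F s" "fst t" "snd t" "F t"]
      F(2) that by simp
  show ?thesis
  proof (intro equivI refl_onI symI transI)
    show "{(s, t). s \<in> ?B \<and> t \<in> ?B \<and> isomorphic_solutions s t} \<subseteq> ?B \<times> ?B" by blast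
  next
    fix s assume "s \<in> ?B"
    then show "(s, s) \<in> {(s, t). s \<in> ?B \<and> t \<in> ?B \<and> isomorphic_solutions s t}"
      by (simp add: iso map_iso_refl)
  next
    fix s t assume "(s, t) \<in> {(s, t). s \<in> ?B \<and> t \<in> ?B \<and> isomorphic_solutions s t}"
    then have "s \<in> ?B" "t \<in> ?B" "isomorphic_solutions s t" by simp_all
    then show "(t, s) \<in> {(s, t). s \<in> ?B \<and> t \<in> ?B \<and> isomorphic_solutions s t}"
      using map_iso_sym[OF _ F(1)] by (simp add: iso)
  next
    fix s t u
    assume "(s, t) \<in> {(s, t). s \<in> ?B \<and> t \<in> ?B \<and> isomorphic_solutions s t}"
      "(t, u) \<in> {(s, t). s \<in> ?B \<and> t \<in> ?B \<and> isomorphic_solutions s t}"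
    then have "s \<in> ?B" "t \<in> ?B" "u \<in> ?B" "isomorphic_solutions s t" "isomorphic_solutions t u"
      by simp_all
    then show "(s, u) \<in> {(s, t). s \<in> ?B \<and> t \<in> ?B \<and> isomorphic_solutions s t}"
      using map_iso_trans by (simp add: iso) blast
  qed
qed

text \<open>All connected maps on \<open>{1..n}\<close> are transported to one fixed carrier
  \<open>X0\<close>, which exists because the type is infinite. Every isomorphism class of solutions
  has a representative on \<open>X0\<close>, so classes correspond to conjugacy classes.\<close>

lemma card_bi_connected_op_solution_classes:
  "card (bi_connected_op_solution_classes n
     :: ('b::infinite set \<times> ('b \<times> 'b \<Rightarrow> 'b \<times> 'b)) set set) = harary n"
proof -
  let ?A = "connected_self_maps n"
  let ?B = "bi_connected_op_solutions n :: ('b set \<times> ('b \<times> 'b \<Rightarrow> 'b \<times> 'b)) set"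
  let ?s = "{(s, t). s \<in> ?B \<and> t \<in> ?B \<and> isomorphic_solutions s t}"
  obtain X0 :: "'b set" where X0: "finite X0" "card X0 = n"
    using infinite_arbitrarily_large[OF infinite_UNIV] by blast
  then obtain h where h: "bij_betw h {1..n} X0"
    using finite_same_card_bij[of "{1..n}" X0] by auto
  have A: "f \<in> {1..n} \<rightarrow> {1..n}" "connected_map {1..n} f" if "f \<in> ?A" for f
    using that by (auto simp: connected_self_maps_def)
  have "\<exists>g. g \<in> X0 \<rightarrow> X0 \<and> map_iso {1..n} f X0 g" if "f \<in> ?A" for f
    by (rule map_iso_transport[OF h A(1)[OF that]]) (auto simp: PiE_iff)
  then obtain G where G: "\<And>f. f \<in> ?A \<Longrightarrow> G f \<in> X0 \<rightarrow> X0"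
    "\<And>f. f \<in> ?A \<Longrightarrow> map_iso {1..n} f X0 (G f)"
    by metis
  \<comment> \<open>On pairs, \<open>map_prod (G f) (G f)\<close> is the solution sending
    \<open>(x, y)\<close> to \<open>(G f x, G f y)\<close>.\<close>
  define \<Phi> where "\<Phi> f = (X0, map_prod (G f) (G f))" for f
  have \<Phi>B: "\<Phi> f \<in> ?B" if "f \<in> ?A" for f
    unfolding \<Phi>_def bi_connected_op_solutions_iff
    using X0 G[OF that] map_iso_connected[OF G(2) A(2) A(1), OF that that that] by auto
  have "bij_betw (\<lambda>C. ?s `` (\<Phi> ` C)) (?A // conjugacy n) (?B // ?s)"
  proof (rule bij_betw_quotient[OF equiv_conjugacy equiv_isomorphic_solutions])
    show "\<Phi> \<in> ?A \<rightarrow> ?B" using \<Phi>B by blast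
  next
    fix f g assume fg: "f \<in> ?A" "g \<in> ?A"
    \<comment> \<open>Composing with the isomorphisms from \<open>f\<close> to \<open>G f\<close>
      and from \<open>g\<close> to \<open>G g\<close>, or their inverses, moves an isomorphism
      between the two carriers.\<close>
    have "map_iso {1..n} f {1..n} g \<longleftrightarrow> map_iso X0 (G f) X0 (G g)"
      using G fg map_iso_sym[OF G(2) A(1)] map_iso_trans by metis
    moreover have "isomorphic_solutions (\<Phi> f) (\<Phi> g) \<longleftrightarrow> map_iso X0 (G f) X0 (G g)"
      unfolding \<Phi>_def by (rule isomorphic_solutions_iff_map_iso) auto
    ultimately show "(f, g) \<in> conjugacy n \<longleftrightarrow> (\<Phi> f, \<Phi> g) \<in> ?s"
      using fg \<Phi>B by (auto simp: conjugacy_iff)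
  next
    fix b assume b: "b \<in> ?B"
    obtain X R where XR: "b = (X, R)" by (cases b)
    obtain f where X: "finite X" "card X = n" and f: "f \<in> X \<rightarrow> X" "connected_map X f"
      and R: "\<And>x y. \<lbrakk>x \<in> X; y \<in> X\<rbrakk> \<Longrightarrow> R (x, y) = (f x, f y)"
      using b unfolding XR bi_connected_op_solutions_iff by blast
    \<comment> \<open>For surjectivity, enumerating the carrier of the given solution produces a map
      \<open>g\<close> on \<open>{1..n}\<close>; then \<open>G g\<close>, \<open>g\<close> and
      \<open>f\<close> are linked by a chain of isomorphisms.\<close>
    obtain k where k: "bij_betw k X {1..n}"
      using finite_same_card_bij[of X "{1..n}"] X by auto
    obtain g where g: "g \<in> {1..n} \<rightarrow>\<^sub>E {1..n}" "map_iso X f {1..n} g"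
      using map_iso_transport[OF k f(1)] by blast
    have gA: "g \<in> ?A"
      using g map_iso_connected[OF g(2) f(2,1)] by (simp add: connected_self_maps_def)
    have "map_iso X0 (G g) X f"
      using map_iso_sym[OF G(2) A(1)] map_iso_sym[OF g(2) f(1)] map_iso_trans gA by blast
    moreover have "isomorphic_solutions (\<Phi> g) b \<longleftrightarrow> map_iso X0 (G g) X f"
      unfolding \<Phi>_def XR by (rule isomorphic_solutions_iff_map_iso) (auto simp: R)
    ultimately show "\<exists>a\<in>?A. (\<Phi> a, b) \<in> ?s"
      using gA \<Phi>B b by blast
  qed
  from bij_betw_same_card[OF this] show ?thesis
    unfolding bi_connected_op_solution_classes_def harary_def by (rule sym)
qed

theorem theoremC:
  fixes X :: "'a set" and dot ast :: "'a \<Rightarrow> 'a \<Rightarrow> 'a"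
    and R :: "'a \<times> 'a \<Rightarrow> 'a \<times> 'a"
  assumes "plonka_bimagma X dot ast"
    and "R = bimagma_map dot ast"
  shows
   "(bi_connected X R \<longleftrightarrow>
      (\<exists>f g. f \<in> X \<rightarrow> X \<and> g \<in> X \<rightarrow> X \<and> (\<forall>x\<in>X. f (g x) = g (f x)) \<and>
             connected_pair X f g \<and> (\<forall>x\<in>X. \<forall>y\<in>X. R (x, y) = (f x, g y)))) \<and>
    ((\<forall>x\<in>X. \<forall>y\<in>X. ast x y = op_dot dot x y) \<longrightarrow>
      (bi_connected X R \<longleftrightarrow>
        (\<exists>f. f \<in> X \<rightarrow> X \<and> connected_map X f \<and>
             (\<forall>x\<in>X. \<forall>y\<in>X. R (x, y) = (f x, f y))))) \<and>
    (\<forall>n>0. card (bi_connected_op_solution_classes n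
                  :: ('b::infinite set \<times> ('b \<times> 'b \<Rightarrow> 'b \<times> 'b)) set set) = harary n)"
proof (intro conjI impI allI)
  interpret plonka_bimagma X dot ast by (fact assms(1))
  show "bi_connected X R \<longleftrightarrow>
      (\<exists>f g. f \<in> X \<rightarrow> X \<and> g \<in> X \<rightarrow> X \<and> (\<forall>x\<in>X. f (g x) = g (f x)) \<and>
             connected_pair X f g \<and> (\<forall>x\<in>X. \<forall>y\<in>X. R (x, y) = (f x, g y)))"
    unfolding assms(2) by (rule bi_connected_iff)
  show "bi_connected X R \<longleftrightarrow>
      (\<exists>f. f \<in> X \<rightarrow> X \<and> connected_map X f \<and> (\<forall>x\<in>X. \<forall>y\<in>X. R (x, y) = (f x, f y)))"
    if "\<forall>x\<in>X. \<forall>y\<in>X. ast x y = op_dot dot x y"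
    unfolding assms(2) by (rule bi_connected_op_iff) (use that in \<open>simp add: op_dot_def\<close>)
  show "card (bi_connected_op_solution_classes n
      :: ('b::infinite set \<times> ('b \<times> 'b \<Rightarrow> 'b \<times> 'b)) set set) = harary n" for n
    by (rule card_bi_connected_op_solution_classes)
qed

end
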